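(* Let $\Phi$ and $\Gamma$ be real-valued functions defined on an interval $I\subseteq\mathbb{R}$ and suppose that $\Phi$ is non-decreasing and right-continuous. Fix $l,u\in\Phi(I)$ with $l<u$ and let $\theta=\partial_-\mathsf{GCM}_{[l,u]}(\Gamma\circ\Phi^-)\circ\Phi$. If $\Phi(I)\cap[l,u]$ is closed, then $$\theta(\mathsf{x})>t\quad\Longleftrightarrow\quad \max\operatorname*{argmax}_{x\in\Phi^-([l,u])}\{t\Phi(x)-\mathsf{LSC}_\Phi(\Gamma)(x)\}<\Phi^-(\Phi(\mathsf{x}))$$ for any $t\in\mathbb{R}$ and any $\mathsf{x}\in I$ with $\Phi(\mathsf{x})\in(l,u)$, where $$\mathsf{LSC}_\Phi(\Gamma)(x)=\mathsf{LSC}(\Gamma\circ\Phi^-)\circ\Phi(x),$$ and where $\mathsf{LSC}(\cdot)$ denotes the greatest lower semi-continuous minorant.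
   Context: $\Phi^-(y)=\inf\{v\in I:\Phi(v)\ge y\}$ is the generalized inverse of $\Phi$ (with the infimum of the empty set equal to $\sup I$), and $\Phi^-([l,u])$ is the image of $[l,u]$ under $\Phi^-$. $\mathsf{GCM}_{[l,u]}(f)$ denotes the greatest convex minorant of $f$ on $[l,u]$, $\partial_-$ denotes the left derivative, and $\circ$ denotes composition; thus $\theta(\mathsf{x})$ is the left derivative of $\mathsf{GCM}_{[l,u]}(\Gamma\circ\Phi^-)$ evaluated at $\Phi(\mathsf{x})$. $\mathsf{LSC}(f)$ is the greatest lower semi-continuous minorant of the function $f$, and $\mathsf{LSC}_\Phi(\Gamma)$ admits the characterization $\mathsf{LSC}_\Phi(\Gamma)(x)=\liminf_{y\to\Phi(x)}(\Gamma\circ\Phi^-)(y)$. For a real-valued function $f$ on a set $X\subset\mathbb{R}$, $\operatorname{argmax}_{x\in X}\{f(x)\}$ is the (possibly empty) set of maximizers of $f$ over $X$; if this set is non-empty and contains a largest element, that element is denoted $\max\operatorname{argmax}_{x\in X}\{f(x)\}$.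
   Formalization: The LSC minorant of Γ∘Φ⁻ is taken over [l,u] only (with a larger domain the claim can fail at l or u); it is also assumed that Φ⁻([l,u]) ⊆ I and that Γ∘Φ⁻ has a convex minorant on [l,u], so that all objects are defined. *)

theory Defs
  imports "HOL-Analysis.Analysis"
begin

text \<open>The infimum and supremum are taken in the extended reals, since \<open>I\<close> may be unbounded.
  The value is always a real number in \<open>I\<close> when \<open>y\<close> lies in \<open>(l,u]\<close> with \<open>l, u \<in> \<Phi>(I)\<close> and
  \<open>\<Phi>\<close> is non-decreasing and right-continuous. At \<open>y = l\<close> it may be \<open>- \<infinity>\<close> or an endpoint of
  \<open>I\<close> that does not belong to \<open>I\<close>.\<close>

definition gen_inverse_ereal :: "real set \<Rightarrow> (real \<Rightarrow> real) \<Rightarrow> real \<Rightarrow> ereal" where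
  "gen_inverse_ereal I \<Phi> y =
     (if {v \<in> I. \<Phi> v \<ge> y} = {} then Sup (ereal ` I)
      else Inf (ereal ` {v \<in> I. \<Phi> v \<ge> y}))"

definition gen_inverse :: "real set \<Rightarrow> (real \<Rightarrow> real) \<Rightarrow> real \<Rightarrow> real" where
  "gen_inverse I \<Phi> y = real_of_ereal (gen_inverse_ereal I \<Phi> y)"

definition convex_minorants :: "real \<Rightarrow> real \<Rightarrow> (real \<Rightarrow> real) \<Rightarrow> (real \<Rightarrow> real) set" where
  "convex_minorants l u f = {h. convex_on {l..u} h \<and> (\<forall>y\<in>{l..u}. h y \<le> f y)}"

text \<open>The real-valued greatest convex minorant on \<open>[l,u]\<close> exists iff there is a convex minorant at
  all (equivalently, iff \<open>f\<close> is bounded below on \<open>[l,u]\<close>); otherwise the supremum below is over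
  the empty set and carries no meaning.\<close>

definition GCM :: "real \<Rightarrow> real \<Rightarrow> (real \<Rightarrow> real) \<Rightarrow> real \<Rightarrow> real" where
  "GCM l u f y = (SUP h \<in> convex_minorants l u f. h y)"

definition lsc_on :: "real set \<Rightarrow> (real \<Rightarrow> real) \<Rightarrow> bool" where
  "lsc_on S h \<longleftrightarrow> (\<forall>x\<in>S. \<forall>c<h x. eventually (\<lambda>y. c < h y) (at x within S))"

definition lsc_minorants :: "real set \<Rightarrow> (real \<Rightarrow> real) \<Rightarrow> (real \<Rightarrow> real) set" where
  "lsc_minorants S f = {h. lsc_on S h \<and> (\<forall>y\<in>S. h y \<le> f y)}"

definition LSC :: "real set \<Rightarrow> (real \<Rightarrow> real) \<Rightarrow> real \<Rightarrow> real" where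
  "LSC S f y = (SUP h \<in> lsc_minorants S f. h y)"

text \<open>\<open>\<Gamma> \<circ> \<Phi>\<^sup>-\<close> is treated as a function on \<open>[l,u]\<close>, as in the greatest convex minorant: values
  outside \<open>[l,u]\<close> do not influence the semicontinuous minorant at the endpoints.\<close>

definition LSC_Phi ::
    "real set \<Rightarrow> (real \<Rightarrow> real) \<Rightarrow> real \<Rightarrow> real \<Rightarrow> (real \<Rightarrow> real) \<Rightarrow> real \<Rightarrow> real" where
  "LSC_Phi I \<Phi> l u \<Gamma> = LSC {l..u} (\<Gamma> \<circ> gen_inverse I \<Phi>) \<circ> \<Phi>"

definition left_deriv :: "(real \<Rightarrow> real) \<Rightarrow> real \<Rightarrow> real" where
  "left_deriv f y = (THE D. (f has_real_derivative D) (at_left y))"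

definition argmax_set :: "(real \<Rightarrow> real) \<Rightarrow> real set \<Rightarrow> real set" where
  "argmax_set f X = {x. is_arg_max f (\<lambda>x. x \<in> X) x}"

text \<open>Meaningful only if the set of maximizers has a largest element.\<close>

definition max_argmax :: "(real \<Rightarrow> real) \<Rightarrow> real set \<Rightarrow> real" where
  "max_argmax f X = (GREATEST x. x \<in> argmax_set f X)"

lemma GCM_greatest:
  assumes "h \<in> convex_minorants l u f" "y \<in> {l..u}"
  shows "h y \<le> GCM l u f y"
  unfolding GCM_def using assms
  by (intro cSUP_upper bdd_aboveI2[where M = "f y"]) (auto simp: convex_minorants_def)

lemma GCM_in_convex_minorants:
  assumes "convex_minorants l u f \<noteq> {}"
  shows "GCM l u f \<in> convex_minorants l u f"
proof -
  have "GCM l u f (a *\<^sub>R x + b *\<^sub>R y) \<le> a * GCM l u f x + b * GCM l u f y"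
    if *: "x \<in> {l..u}" "y \<in> {l..u}" "a \<ge> 0" "b \<ge> 0" "a + b = 1" for x y a b
    unfolding GCM_def[of l u f "a *\<^sub>R x + b *\<^sub>R y"]
  proof (rule cSUP_least[OF assms])
    fix h assume h: "h \<in> convex_minorants l u f"
    have "h (a *\<^sub>R x + b *\<^sub>R y) \<le> a * h x + b * h y"
      using h * by (auto simp: convex_minorants_def convex_on_def)
    also have "\<dots> \<le> a * GCM l u f x + b * GCM l u f y"
      using * by (intro add_mono mult_left_mono GCM_greatest h) auto
    finally show "h (a *\<^sub>R x + b *\<^sub>R y) \<le> a * GCM l u f x + b * GCM l u f y" .
  qed
  moreover have "GCM l u f y \<le> f y" if "y \<in> {l..u}" for y
    unfolding GCM_def using that
    by (intro cSUP_least[OF assms]) (auto simp: convex_minorants_def)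
  ultimately show ?thesis
    by (simp add: convex_minorants_def convex_on_def)
qed

lemma LSC_greatest:
  assumes "h \<in> lsc_minorants S f" "y \<in> S"
  shows "h y \<le> LSC S f y"
  unfolding LSC_def using assms
  by (intro cSUP_upper bdd_aboveI2[where M = "f y"]) (auto simp: lsc_minorants_def)

lemma LSC_in_lsc_minorants:
  assumes "lsc_minorants S f \<noteq> {}"
  shows "LSC S f \<in> lsc_minorants S f"
proof -
  have "eventually (\<lambda>y. c < LSC S f y) (at x within S)"
    if x: "x \<in> S" and c: "c < LSC S f x" for x c
  proof -
    have "bdd_above ((\<lambda>h. h x) ` lsc_minorants S f)"
      using x by (intro bdd_aboveI2[where M = "f x"]) (auto simp: lsc_minorants_def)
    then obtain h where h: "h \<in> lsc_minorants S f" "c < h x"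
      using c assms unfolding LSC_def by (auto simp: less_cSUP_iff)
    then have "eventually (\<lambda>y. c < h y) (at x within S)"
      using x by (auto simp: lsc_minorants_def lsc_on_def)
    moreover have "eventually (\<lambda>y. y \<in> S) (at x within S)"
      by (simp add: eventually_at_filter)
    ultimately show ?thesis
      by eventually_elim (use LSC_greatest[OF h(1)] in \<open>force intro: less_le_trans\<close>)
  qed
  moreover have "LSC S f y \<le> f y" if "y \<in> S" for y
    unfolding LSC_def using that
    by (intro cSUP_least[OF assms]) (auto simp: lsc_minorants_def)
  ultimately show ?thesis
    by (simp add: lsc_minorants_def lsc_on_def)
qed

end

theory Submission
  imports Defs
begin

text \<open>Write \<open>G = \<Gamma> \<circ> \<Phi>\<^sup>-\<close>, \<open>L = LSC G\<close> and \<open>C = \<Phi>(I) \<inter> [l,u]\<close>. Since \<open>C\<close> is closed, \<open>G\<close> is constant on each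
  gap of \<open>C\<close> up to its right end, so \<open>L = G\<close> on the gap and neither end of the gap has a larger
  value of \<open>L\<close>. Hence the largest maximizer \<open>m\<close> of \<open>t s - L(s)\<close> over \<open>[l,u]\<close> exists and lies in
  \<open>C\<close>, on which \<open>\<Phi>\<^sup>-\<close> is a strictly increasing inverse of \<open>\<Phi>\<close>. It remains to see that the left
  derivative \<open>D\<close> of the convex minorant at \<open>y\<close> exceeds \<open>t\<close> iff \<open>m < y\<close>. Let \<open>M = t m - L(m)\<close>.
  If \<open>D > t\<close> but \<open>y \<le> m\<close>, the support line at \<open>y\<close> lies below \<open>L\<close> at \<open>m\<close>, so the minorant touches
  \<open>t s - M\<close> at \<open>y\<close> while lying above it everywhere, which forces \<open>D \<le> t\<close>. If \<open>m < y\<close>, the line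
  \<open>t s - M\<close> can be bent upwards between \<open>m\<close> and \<open>y\<close> and stay below \<open>G\<close>; were \<open>D \<le> t\<close>, a line
  parallel to it and strictly above it would lie below \<open>G\<close>, hence below \<open>L\<close>, contradicting the
  value at \<open>m\<close>. Comparing with continuous minorants of \<open>G\<close> avoids using that the convex minorant
  lies below \<open>L\<close>, which may fail at the end points \<open>l\<close> and \<open>u\<close>.\<close>

section \<open>Left derivatives of convex functions\<close>

text \<open>Left difference quotients at \<open>y\<close> increase with \<open>s\<close> and are
  bounded by those from the right, so their supremum \<open>D\<close> is the left limit. As
  \<open>left_deriv\<close> is a definite description, existence and uniqueness of this limit come
  first.\<close>

lemma left_deriv_convex:
  fixes g :: "real \<Rightarrow> real"
  assumes g: "convex_on {l..u} g" and y: "l < y" "y < u"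
  shows support_line_left_deriv: "s \<in> {l..u} \<Longrightarrow> g y + left_deriv g y * (s - y) \<le> g s"
    and left_deriv_le: "(\<And>s. s \<in> {l..<y} \<Longrightarrow> g y - g s \<le> t * (y - s)) \<Longrightarrow> left_deriv g y \<le> t"
proof -
  define q where "q s = (g s - g y) / (s - y)" for s
  define D where "D = (SUP s\<in>{l..<y}. q s)"
  have q_mono: "q s \<le> q s'" if "l \<le> s" "s < s'" "s' < y" for s s'
    unfolding q_def using convex_on_slope_le(2)[OF g, of s y s'] that y by auto
  have q_bound: "q s \<le> q s'" if "s \<in> {l..<y}" "s' \<in> {y<..u}" for s s'
  proof -
    have "q s \<le> (g s - g s') / (s - s')"
      unfolding q_def using convex_on_slope_le(1)[OF g, of s s' y] that by auto
    also have "\<dots> \<le> (g y - g s') / (y - s')"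
      using convex_on_slope_le(2)[OF g, of s s' y] that by auto
    also have "\<dots> = q s'"
      unfolding q_def by (metis minus_diff_eq minus_divide_divide)
    finally show ?thesis .
  qed
  have bdd: "bdd_above (q ` {l..<y})"
    using y q_bound[of _ u] by (intro bdd_aboveI2[where M = "q u"]) auto
  have ne: "{l..<y} \<noteq> {}"
    using y by auto
  have q_le: "q s \<le> D" if "s \<in> {l..<y}" for s
    unfolding D_def using bdd that by (intro cSUP_upper) auto
  have D_le: "D \<le> c" if "\<And>s. s \<in> {l..<y} \<Longrightarrow> q s \<le> c" for c
    unfolding D_def using ne that by (intro cSUP_least) auto
  have ev: "eventually (\<lambda>s. a < s \<and> s < y) (at_left y)" if "a < y" for a
    unfolding eventually_at_left[OF that] using that by blast
  have "(q \<longlongrightarrow> D) (at_left y)"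
  proof (rule order_tendstoI)
    fix a assume "a < D"
    then obtain s where s: "s \<in> {l..<y}" "a < q s"
      unfolding D_def using less_cSUP_iff[OF ne bdd] by auto
    then have "s < y" by simp
    show "eventually (\<lambda>r. a < q r) (at_left y)"
    proof (rule eventually_mono[OF ev[OF \<open>s < y\<close>]])
      show "a < q r" if "s < r \<and> r < y" for r
        using s(2) q_mono[of s r] s(1) that by auto
    qed
  next
    fix a assume "D < a"
    show "eventually (\<lambda>r. q r < a) (at_left y)"
    proof (rule eventually_mono[OF ev[OF y(1)]])
      show "q r < a" if "l < r \<and> r < y" for r
        using q_le[of r] \<open>D < a\<close> that by auto
    qed
  qed
  then have D: "(g has_real_derivative D) (at_left y)"
    by (simp add: has_field_derivative_iff q_def[abs_def])
  have "left_deriv g y = D"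
    unfolding left_deriv_def
  proof (rule the_equality)
    fix E assume "(g has_real_derivative E) (at_left y)"
    then show "E = D"
      using D unfolding has_field_derivative_iff
      by (meson tendsto_unique trivial_limit_at_left_real)
  qed (rule D)
  note left_D = this
  show "g y + left_deriv g y * (s - y) \<le> g s" if s: "s \<in> {l..u}"
  proof (cases s y rule: linorder_cases)
    case less
    then have "q s \<le> D"
      using s by (intro q_le) auto
    then show ?thesis
      using less by (simp add: left_D q_def field_simps)
  next
    case greater
    then have "D \<le> q s"
      using s by (intro D_le q_bound) auto
    then show ?thesis
      using greater by (simp add: left_D q_def field_simps)
  qed (simp add: left_D)
  show "left_deriv g y \<le> t" if le: "\<And>s. s \<in> {l..<y} \<Longrightarrow> g y - g s \<le> t * (y - s)"
    unfolding left_D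
  proof (rule D_le)
    fix s assume "s \<in> {l..<y}"
    then show "q s \<le> t"
      using le[of s] by (auto simp: q_def field_simps)
  qed
qed

section \<open>Lower semicontinuity, minimisers and the envelope\<close>

lemma lsc_on_diff_continuous:
  assumes "lsc_on S h" "continuous_on S k"
  shows "lsc_on S (\<lambda>s. h s - k s)"
  unfolding lsc_on_def
proof (intro ballI allI impI)
  fix x c assume x: "x \<in> S" and c: "c < h x - k x"
  define e where "e = (h x - k x - c) / 2"
  have e: "e > 0"
    using c by (simp add: e_def)
  have "eventually (\<lambda>s. h x - e < h s) (at x within S)"
    using assms(1) x e by (auto simp: lsc_on_def)
  moreover have "eventually (\<lambda>s. k s < k x + e) (at x within S)"
    using assms(2) x e by (intro order_tendstoD) (auto simp: continuous_on_def)
  ultimately show "eventually (\<lambda>s. c < h s - k s) (at x within S)"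
    by eventually_elim (simp add: e_def field_simps)
qed

lemma continuous_on_imp_lsc_on:
  assumes "continuous_on S h"
  shows "lsc_on S h"
  using assms unfolding lsc_on_def continuous_on_def by (blast dest: order_tendstoD(1))

lemma lsc_on_subset:
  assumes "lsc_on S h" "T \<subseteq> S"
  shows "lsc_on T h"
  using assms unfolding lsc_on_def by (meson at_le filter_leD subsetD)

lemma closed_lsc_sublevel:
  assumes "lsc_on S h" "closed S"
  shows "closed {s \<in> S. h s \<le> c}"
  unfolding closed_limpt
proof (intro allI impI)
  fix x assume x: "x islimpt {s \<in> S. h s \<le> c}"
  have xS: "x \<in> S"
    using x assms(2) unfolding closed_limpt by (metis (no_types, lifting) islimpt_subset mem_Collect_eq subsetI)
  moreover have "h x \<le> c"
  proof (rule ccontr)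
    assume "\<not> h x \<le> c"
    then have "eventually (\<lambda>s. c < h s) (at x within S)"
      using assms(1) xS by (auto simp: lsc_on_def)
    then have "eventually (\<lambda>s. s \<notin> {s \<in> S. h s \<le> c}) (at x)"
      unfolding eventually_at_filter by (rule eventually_mono) auto
    then show False
      using x by (simp add: islimpt_iff_eventually)
  qed
  ultimately show "x \<in> {s \<in> S. h s \<le> c}"
    by simp
qed

text \<open>A minimiser is a common point of the closed sublevel sets at attained levels; any
  finitely many of them share the point of lowest level.\<close>

lemma lsc_attains_inf:
  fixes h :: "real \<Rightarrow> real"
  assumes h: "lsc_on S h" and S: "compact S" "S \<noteq> {}"
  obtains x where "x \<in> S" "\<And>y. y \<in> S \<Longrightarrow> h x \<le> h y"
proof -
  have "S \<inter> \<Inter> ((\<lambda>y. {s \<in> S. h s \<le> h y}) ` S) \<noteq> {}"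
  proof (rule compact_imp_fip_image[OF S(1)])
    show "closed {s \<in> S. h s \<le> h y}" for y
      using h S by (intro closed_lsc_sublevel compact_imp_closed)
    fix I' assume I': "finite I'" "I' \<subseteq> S"
    show "S \<inter> (\<Inter>y\<in>I'. {s \<in> S. h s \<le> h y}) \<noteq> {}"
    proof (cases "I' = {}")
      case False
      then obtain x where x: "x \<in> I'" "\<And>y. y \<in> I' \<Longrightarrow> h x \<le> h y"
        using I'(1) by (metis arg_min_if_finite(1) arg_min_least)
      then have "x \<in> S \<inter> (\<Inter>y\<in>I'. {s \<in> S. h s \<le> h y})"
        using I' by auto
      then show ?thesis by blast
    qed (use S in auto)
  qed
  then obtain x where "x \<in> S" "\<forall>y\<in>S. h x \<le> h y"
    by blast
  then show ?thesis
    using that[of x] by simp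
qed

text \<open>The minimisers form a closed sublevel set inside a compact set, so there is a largest
  one.\<close>

lemma compact_greatest_minimiser:
  fixes h :: "real \<Rightarrow> real"
  assumes h: "lsc_on S h" and S: "compact S" "S \<noteq> {}"
  obtains x where "x \<in> S" "\<And>y. y \<in> S \<Longrightarrow> h x \<le> h y" "\<And>y. y \<in> S \<Longrightarrow> x < y \<Longrightarrow> h x < h y"
proof -
  obtain x where x: "x \<in> S" "\<And>y. y \<in> S \<Longrightarrow> h x \<le> h y"
    using lsc_attains_inf[OF assms] by blast
  define K where "K = {s \<in> S. h s \<le> h x}"
  have "closed K"
    unfolding K_def using h S by (intro closed_lsc_sublevel compact_imp_closed)
  then have "compact (S \<inter> K)"
    using S by (intro compact_Int_closed)
  moreover have "S \<inter> K = K"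
    by (auto simp: K_def)
  moreover have "K \<noteq> {}"
    using x by (auto simp: K_def)
  ultimately obtain m where m: "m \<in> K" "\<And>y. y \<in> K \<Longrightarrow> y \<le> m"
    using compact_attains_sup by metis
  show ?thesis
  proof (rule that)
    show "m \<in> S"
      using m by (simp add: K_def)
    show "h m \<le> h y" if "y \<in> S" for y
      using m(1) x(2)[OF that] by (simp add: K_def)
    show "h m < h y" if "y \<in> S" "m < y" for y
      using m(1) m(2)[of y] that by (force simp: K_def)
  qed
qed

lemma continuous_le_LSC:
  assumes "continuous_on S h" "\<And>s. s \<in> S \<Longrightarrow> h s \<le> G s" "s \<in> S"
  shows "h s \<le> LSC S G s"
  using assms by (intro LSC_greatest) (auto simp: lsc_minorants_def continuous_on_imp_lsc_on)

text \<open>Replacing the lower semicontinuous envelope by \<open>G\<close> off \<open>C\<close> keeps it lower semicontinuous.\<close>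

lemma LSC_eq_off_closed:
  assumes ne: "lsc_minorants S G \<noteq> {}" and s: "s \<in> S" "s \<notin> C"
    and G: "\<And>x. x \<in> S - C \<Longrightarrow> eventually (\<lambda>z. z \<notin> C \<and> G z = G x) (at x within S)"
  shows "LSC S G s = G s"
proof -
  note L = LSC_in_lsc_minorants[OF ne]
  have le: "LSC S G y \<le> G y" if "y \<in> S" for y
    using L that by (simp add: lsc_minorants_def)
  define h where "h y = (if y \<in> C then LSC S G y else G y)" for y
  have "lsc_on S h"
    unfolding lsc_on_def
  proof (intro ballI allI impI)
    fix x c assume x: "x \<in> S" and c: "c < h x"
    show "eventually (\<lambda>y. c < h y) (at x within S)"
    proof (cases "x \<in> C")
      case True
      then have "eventually (\<lambda>y. c < LSC S G y) (at x within S)"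
        using L x c by (auto simp: lsc_minorants_def lsc_on_def h_def)
      moreover have "eventually (\<lambda>y. y \<in> S) (at x within S)"
        by (simp add: eventually_at_filter)
      ultimately show ?thesis
        by eventually_elim (use le in \<open>force simp: h_def intro: less_le_trans\<close>)
    next
      case False
      then show ?thesis
        using G[of x] x c by (auto simp: h_def elim!: eventually_mono)
    qed
  qed
  then have "h \<in> lsc_minorants S G"
    using le by (auto simp: lsc_minorants_def h_def)
  then have "h s \<le> LSC S G s"
    using s by (intro LSC_greatest)
  then show ?thesis
    using le s by (simp add: h_def order_antisym)
qed

section \<open>Convex minorants and the slope criterion\<close>

text \<open>Both minorants built below have this shape: a line for \<open>d = 0\<close>, a line bent
  upwards at \<open>c\<close> for \<open>d > 0\<close>.\<close>

lemma convex_on_affine_max: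
  fixes t M d c :: real
  assumes "d \<ge> 0"
  shows "convex_on {l..u} (\<lambda>s. t * s - M + d * max 0 (s - c))"
proof (rule convex_on_linorderI)
  fix r x y :: real assume r: "0 < r" "r < 1"
  have "(1 - r) * x + r * y - c = (1 - r) * (x - c) + r * (y - c)"
    by (simp add: algebra_simps)
  also have "\<dots> \<le> (1 - r) * max 0 (x - c) + r * max 0 (y - c)"
    using r by (intro add_mono mult_left_mono) auto
  finally have "max 0 ((1 - r) * x + r * y - c) \<le> (1 - r) * max 0 (x - c) + r * max 0 (y - c)"
    using r by auto
  then have "d * max 0 ((1 - r) * x + r * y - c) \<le> d * ((1 - r) * max 0 (x - c) + r * max 0 (y - c))"
    using assms by (intro mult_left_mono)
  then show "t * ((1 - r) *\<^sub>R x + r *\<^sub>R y) - M + d * max 0 ((1 - r) *\<^sub>R x + r *\<^sub>R y - c)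
      \<le> (1 - r) * (t * x - M + d * max 0 (x - c)) + r * (t * y - M + d * max 0 (y - c))"
    by (simp add: algebra_simps)
qed simp

text \<open>A convex minorant can fail lower semicontinuity at \<open>l\<close> and
  \<open>u\<close>, but its support line at the midpoint is continuous and still lies below
  \<open>G\<close>.\<close>

lemma lsc_minorants_nonempty:
  assumes ne: "convex_minorants l u G \<noteq> {}" and "l < u"
  shows "lsc_minorants {l..u} G \<noteq> {}"
proof -
  define y where "y = (l + u) / 2"
  have y: "l < y" "y < u"
    using \<open>l < u\<close> by (auto simp: y_def)
  obtain h where h: "convex_on {l..u} h" "\<And>s. s \<in> {l..u} \<Longrightarrow> h s \<le> G s"
    using ne by (auto simp: convex_minorants_def)
  have "h y + left_deriv h y * (s - y) \<le> G s" if "s \<in> {l..u}" for s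
    using support_line_left_deriv[OF h(1) y that] h(2)[OF that] by simp
  then have "(\<lambda>s. h y + left_deriv h y * (s - y)) \<in> lsc_minorants {l..u} G"
    by (auto simp: lsc_minorants_def intro!: continuous_on_imp_lsc_on continuous_intros)
  then show ?thesis
    by blast
qed

text \<open>Here \<open>G\<close> is arbitrary; \<open>\<Phi>\<close> and \<open>C\<close> enter
  later, through the choice of \<open>m\<close>, the largest minimiser of \<open>k\<close>.\<close>

lemma left_deriv_GCM_gt_iff:
  fixes G :: "real \<Rightarrow> real" and l u t :: real
  defines "k \<equiv> \<lambda>s. LSC {l..u} G s - t * s"
  assumes ne: "convex_minorants l u G \<noteq> {}" and y: "l < y" "y < u"
    and m: "m \<in> {l..u}" "\<And>s. s \<in> {l..u} \<Longrightarrow> k m \<le> k s"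
      "\<And>s. s \<in> {l..u} \<Longrightarrow> m < s \<Longrightarrow> k m < k s"
  shows "t < left_deriv (GCM l u G) y \<longleftrightarrow> m < y"
proof -
  define g where "g = GCM l u G"
  define L where "L = LSC {l..u} G"
  define D where "D = left_deriv g y"
  have g: "convex_on {l..u} g" and gG: "\<And>s. s \<in> {l..u} \<Longrightarrow> g s \<le> G s"
    using GCM_in_convex_minorants[OF ne] by (auto simp: convex_minorants_def g_def)
  have support: "g y + D * (s - y) \<le> g s" if "s \<in> {l..u}" for s
    using support_line_left_deriv[OF g y that] by (simp add: D_def)
  have support_G: "g y + D * (s - y) \<le> G s" if "s \<in> {l..u}" for s
    using support[OF that] gG[OF that] by simp
  have "L \<in> lsc_minorants {l..u} G"
    unfolding L_def using y by (intro LSC_in_lsc_minorants lsc_minorants_nonempty[OF ne]) simp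
  then have lscL: "lsc_on {l..u} L" and LG: "\<And>s. s \<in> {l..u} \<Longrightarrow> L s \<le> G s"
    by (auto simp: lsc_minorants_def)
  define M where "M = - k m"
  have Lm: "L m = t * m - M"
    by (simp add: M_def k_def L_def)
  have L_ge: "t * s - M \<le> L s" if "s \<in> {l..u}" for s
    using m(2)[OF that] by (simp add: M_def k_def L_def)
  show ?thesis
  proof
    assume D: "t < left_deriv (GCM l u G) y"
    then have D: "t < D"
      by (simp add: D_def g_def)
    show "m < y"
    proof (rule ccontr)
      assume "\<not> m < y"
      then have "y \<le> m" by simp
      \<comment> \<open>The support line is a continuous minorant of \<open>G\<close>, so it is
        below \<open>L\<close> even if \<open>m = u\<close>.\<close>
      have "g y + D * (m - y) \<le> L m"
        unfolding L_def using m(1) support_G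
        by (intro continuous_le_LSC[where h = "\<lambda>s. g y + D * (s - y)"] continuous_intros) auto
      then have "g y \<le> t * y - M - (D - t) * (m - y)"
        by (simp add: Lm algebra_simps)
      also have "\<dots> \<le> t * y - M"
        using D \<open>y \<le> m\<close> by simp
      finally have gy: "g y \<le> t * y - M" .
      have "t * s - M \<le> G s" if "s \<in> {l..u}" for s
        using L_ge[OF that] LG[OF that] by simp
      then have *: "(\<lambda>s. t * s - M) \<in> convex_minorants l u G"
        using convex_on_affine_max[of 0 l u t M l] by (simp add: convex_minorants_def)
      \<comment> \<open>The line of slope \<open>t\<close> lies below \<open>g\<close> and meets it
        at \<open>y\<close>, so no left quotient exceeds \<open>t\<close>.\<close>
      have "D \<le> t"
        unfolding D_def
      proof (rule left_deriv_le[OF g y])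
        fix s assume "s \<in> {l..<y}"
        then have "t * s - M \<le> g s"
          using GCM_greatest[OF *, of s] y by (simp add: g_def)
        then show "g y - g s \<le> t * (y - s)"
          using gy by (simp add: algebra_simps)
      qed
      then show False
        using D by simp
    qed
  next
    assume "m < y"
    \<comment> \<open>Since \<open>c\<close> separates \<open>m\<close> from \<open>y\<close>, the
      minimum of \<open>k\<close> over the compact \<open>{c..u}\<close> exceeds \<open>k m\<close>
      by a positive \<open>\<epsilon>\<close>, which is the room for bending.\<close>
    define c where "c = (m + y) / 2"
    have c: "m < c" "c < y" "l \<le> c" "c < u"
      using \<open>m < y\<close> m(1) y by (auto simp: c_def)
    have "lsc_on {c..u} k"
      using lscL c unfolding k_def L_def
      by (intro lsc_on_diff_continuous continuous_intros) (auto intro: lsc_on_subset)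
    then obtain x where x: "x \<in> {c..u}" "\<And>s. s \<in> {c..u} \<Longrightarrow> k x \<le> k s"
      using c by (rule_tac lsc_attains_inf[of "{c..u}" k]) auto
    define \<epsilon> where "\<epsilon> = k x - k m"
    have \<epsilon>: "\<epsilon> > 0"
      using m(3)[of x] x(1) c by (simp add: \<epsilon>_def)
    have L_ge': "t * s - M + \<epsilon> \<le> L s" if "s \<in> {c..u}" for s
      using x(2)[OF that] by (simp add: \<epsilon>_def M_def k_def L_def)
    \<comment> \<open>This is the largest slope whose rise over \<open>{c..u}\<close> is at most
      \<open>\<epsilon>\<close>.\<close>
    define d where "d = \<epsilon> / (u - c)"
    have d: "d > 0"
      using \<epsilon> c by (simp add: d_def)
    define h where "h s = t * s - M + d * max 0 (s - c)" for s
    have "h s \<le> G s" if s: "s \<in> {l..u}" for s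
    proof (cases "s \<le> c")
      case True
      then show ?thesis
        using L_ge[OF s] LG[OF s] by (simp add: h_def)
    next
      case False
      have "d * (s - c) \<le> d * (u - c)"
        using d s by (intro mult_left_mono) auto
      also have "\<dots> = \<epsilon>"
        using c by (simp add: d_def)
      finally show ?thesis
        using L_ge'[of s] LG[OF s] False s by (simp add: h_def max_def)
    qed
    then have "h \<in> convex_minorants l u G"
      using convex_on_affine_max[of d l u t M c] d by (simp add: convex_minorants_def h_def[abs_def])
    then have "h y \<le> g y"
      unfolding g_def using y by (intro GCM_greatest) auto
    then have gy: "t * y - M + d * (y - c) \<le> g y"
      using c by (simp add: h_def)
    \<comment> \<open>Left of \<open>y\<close> the support line of slope at most \<open>t\<close>
      leaves the margin \<open>d * (y - c)\<close>; from \<open>y\<close> on the margin is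
      \<open>\<epsilon>\<close>. The smaller one serves throughout.\<close>
    define \<delta> where "\<delta> = min \<epsilon> (d * (y - c))"
    have \<delta>: "\<delta> > 0"
      using \<epsilon> d c by (simp add: \<delta>_def)
    show "t < left_deriv (GCM l u G) y"
    proof (rule ccontr)
      assume "\<not> t < left_deriv (GCM l u G) y"
      then have D: "D \<le> t"
        by (simp add: D_def g_def)
      have "t * s - M + \<delta> \<le> G s" if s: "s \<in> {l..u}" for s
      proof (cases "s < y")
        case True
        then have "t * (s - y) \<le> D * (s - y)"
          using D by (intro mult_right_mono_neg) auto
        then show ?thesis
          using gy support_G[OF s] by (simp add: \<delta>_def algebra_simps)
      next
        case False
        then show ?thesis
          using L_ge'[of s] LG[OF s] s c by (simp add: \<delta>_def)
      qed
      then have "t * m - M + \<delta> \<le> L m"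
        unfolding L_def using m(1)
        by (intro continuous_le_LSC[where h = "\<lambda>s. t * s - M + \<delta>"] continuous_intros) auto
      then show False
        using Lm \<delta> by simp
    qed
  qed
qed

section \<open>Locating the minimiser in a closed set with constant gaps\<close>

text \<open>Minimising over the compact \<open>C\<close> suffices, because moving from a gap to a
  suitable end does not increase \<open>k\<close>. The half-open \<open>{s..<s'}\<close> makes
  \<open>G\<close> at the right end agree with the gap, while at the left end it may differ.\<close>

lemma greatest_minimiser_LSC_in_closed:
  fixes G :: "real \<Rightarrow> real" and l u t :: real
  defines "k \<equiv> \<lambda>s. LSC {l..u} G s - t * s"
  assumes ne: "lsc_minorants {l..u} G \<noteq> {}"
    and C: "closed C" "C \<subseteq> {l..u}" "l \<in> C" "u \<in> C"
    and G: "\<And>s s'. s \<in> {l..u} \<Longrightarrow> s' \<in> {l..u} \<Longrightarrow> s \<le> s' \<Longrightarrow> C \<inter> {s..<s'} = {} \<Longrightarrow> G s = G s'"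
  obtains m where "m \<in> C" "\<And>s. s \<in> {l..u} \<Longrightarrow> k m \<le> k s"
    "\<And>s. s \<in> {l..u} \<Longrightarrow> m < s \<Longrightarrow> k m < k s"
proof -
  define L where "L = LSC {l..u} G"
  have lscL: "lsc_on {l..u} L" and LG: "\<And>s. s \<in> {l..u} \<Longrightarrow> L s \<le> G s"
    using LSC_in_lsc_minorants[OF ne] by (auto simp: lsc_minorants_def L_def)
  have locally_const: "eventually (\<lambda>z. z \<notin> C \<and> G z = G x) (at x within {l..u})"
    if x: "x \<in> {l..u} - C" for x
  proof -
    have "open (- C)" "x \<in> - C"
      using C x by auto
    then obtain e where e: "e > 0" "\<And>z. dist z x < e \<Longrightarrow> z \<in> - C"
      unfolding open_dist by blast
    have const: "G z = G x" if z: "z \<in> {l..u}" "dist z x < e" for z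
    proof (cases "z \<le> x")
      case True
      then show ?thesis
        using x z e(2) by (intro G) (force simp: dist_real_def)+
    next
      case False
      then show ?thesis
        using x z e(2) by (intro G[symmetric]) (force simp: dist_real_def)+
    qed
    show ?thesis
      unfolding eventually_at using e const by (intro exI[of _ e]) auto
  qed
  have L_eq: "L s = G s" if "s \<in> {l..u}" "s \<notin> C" for s
    unfolding L_def using locally_const by (intro LSC_eq_off_closed[OF ne that]) auto
  have gap: "\<exists>a b. a \<in> C \<and> b \<in> C \<and> a < s \<and> s < b \<and> L a \<le> L s \<and> L b \<le> L s"
    if s: "s \<in> {l..u}" "s \<notin> C" for s
  proof -
    have "compact (C \<inter> {l..s})" "compact (C \<inter> {s..u})"
      using C by (auto intro: closed_Int_compact)
    moreover have "C \<inter> {l..s} \<noteq> {}" "C \<inter> {s..u} \<noteq> {}"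
      using C s by auto
    ultimately obtain a b where a: "a \<in> C \<inter> {l..s}" "\<forall>z\<in>C \<inter> {l..s}. z \<le> a"
      and b: "b \<in> C \<inter> {s..u}" "\<forall>z\<in>C \<inter> {s..u}. b \<le> z"
      using compact_attains_sup compact_attains_inf by metis
    have ab: "a < s" "s < b" "a \<in> {l..u}" "b \<in> {l..u}"
      using a(1) b(1) s C by (auto simp: less_le)
    have no_C: "z \<notin> C" if "a < z" "z < b" for z
      using a(2) b(2) that ab C by force
    have "G s = G b"
      using s ab no_C by (intro G) force+
    then have Lb: "L b \<le> L s"
      using LG[OF ab(4)] L_eq[OF s] by simp
    \<comment> \<open>\<open>G a\<close> is not tied to the gap, so semicontinuity at
      \<open>a\<close> is used: if \<open>L a\<close> exceeded \<open>L s\<close>, so would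
      \<open>L z\<close> for \<open>z\<close> slightly right of \<open>a\<close>, yet
      \<open>L\<close> is constant on the gap.\<close>
    have La: "L a \<le> L s"
    proof (rule ccontr)
      assume "\<not> L a \<le> L s"
      then have "eventually (\<lambda>z. L s < L z) (at a within {l..u})"
        using lscL ab by (auto simp: lsc_on_def)
      then obtain e where e: "e > 0" "\<And>z. z \<in> {l..u} \<Longrightarrow> z \<noteq> a \<Longrightarrow> dist z a < e \<Longrightarrow> L s < L z"
        unfolding eventually_at by blast
      define z where "z = a + min (s - a) e / 2"
      have z: "a < z" "z < s" "dist z a < e"
        using e(1) ab by (auto simp: z_def dist_real_def min_def field_simps)
      then have zl: "z \<in> {l..u}"
        using ab by auto
      have "L s < L z"
        using e z zl by auto
      moreover have "G z = G s"
        using z zl ab s no_C by (intro G) force+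
      ultimately show False
        using L_eq[OF s] L_eq[OF zl] no_C z ab by auto
    qed
    show ?thesis
      using a(1) b(1) ab La Lb by blast
  qed
  have "lsc_on C k"
    unfolding k_def using lscL C
    by (intro lsc_on_diff_continuous continuous_intros) (auto simp: L_def intro: lsc_on_subset)
  moreover have "compact C"
    using C(1,2) by (metis closed_Int_compact compact_Icc inf.absorb1)
  ultimately obtain m where m: "m \<in> C" "\<And>s. s \<in> C \<Longrightarrow> k m \<le> k s"
    "\<And>s. s \<in> C \<Longrightarrow> m < s \<Longrightarrow> k m < k s"
    using compact_greatest_minimiser[of C k] C(3) by blast
  have k_gap: "k m \<le> k s \<and> (m < s \<longrightarrow> k m < k s)" if s: "s \<in> {l..u}" "s \<notin> C" for s
  proof -
    obtain a b where ab: "a \<in> C" "b \<in> C" "a < s" "s < b" "L a \<le> L s" "L b \<le> L s"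
      using gap[OF s] by blast
    show ?thesis
    \<comment> \<open>The sign of \<open>t\<close> selects the end: the right one for
      \<open>t \<ge> 0\<close>, where strictness survives since \<open>m < s < b\<close>, and the
      left one for \<open>t < 0\<close>, where \<open>k\<close> drops strictly.\<close>
    proof (cases "t \<ge> 0")
      case True
      then have "t * s \<le> t * b"
        using ab by (intro mult_left_mono) auto
      then have "k b \<le> k s"
        using ab by (simp add: k_def L_def)
      then show ?thesis
        using m(2)[OF ab(2)] m(3)[OF ab(2)] ab(4) by auto
    next
      case False
      then have "t * s < t * a"
        using ab by simp
      then have "k a < k s"
        using ab by (simp add: k_def L_def)
      then show ?thesis
        using m(2)[OF ab(1)] by auto
    qed
  qed
  show ?thesis
  proof (rule that[OF m(1)])
    fix s assume s: "s \<in> {l..u}"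
    show "k m \<le> k s"
      using m(2)[of s] k_gap[OF s] by (cases "s \<in> C") auto
    show "k m < k s" if "m < s"
      using m(3)[of s] k_gap[OF s] that by (cases "s \<in> C") auto
  qed
qed

section \<open>The generalized inverse\<close>

text \<open>Assumptions \<open>y\<close> and \<open>ne\<close> rule out infinite values and the
  default \<open>Sup\<close>, so the value is a real infimum \<open>p\<close>. If
  \<open>\<Phi> p < y\<close>, right-continuity would keep \<open>\<Phi>\<close> below
  \<open>y\<close> just after \<open>p\<close>, pushing the infimum beyond \<open>p\<close>.\<close>

lemma gen_inverse_props:
  assumes rc: "\<forall>v\<in>I. continuous (at v within (I \<inter> {v..})) \<Phi>"
    and y: "gen_inverse_ereal I \<Phi> y \<in> ereal ` I" and ne: "\<exists>v\<in>I. y \<le> \<Phi> v"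
  shows gen_inverse_mem: "gen_inverse I \<Phi> y \<in> I"
    and gen_inverse_le: "\<And>v. v \<in> I \<Longrightarrow> y \<le> \<Phi> v \<Longrightarrow> gen_inverse I \<Phi> y \<le> v"
    and le_Phi_gen_inverse: "y \<le> \<Phi> (gen_inverse I \<Phi> y)"
proof -
  let ?S = "{v \<in> I. \<Phi> v \<ge> y}"
  define p where "p = gen_inverse I \<Phi> y"
  have "gen_inverse_ereal I \<Phi> y = Inf (ereal ` ?S)"
    using ne by (auto simp: gen_inverse_ereal_def)
  moreover have "gen_inverse_ereal I \<Phi> y = ereal p" and pI: "p \<in> I"
    using y by (auto simp: p_def gen_inverse_def)
  ultimately have p: "ereal p = Inf (ereal ` ?S)"
    by simp
  show "gen_inverse I \<Phi> y \<in> I"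
    using pI by (simp add: p_def)
  show "gen_inverse I \<Phi> y \<le> v" if "v \<in> I" "y \<le> \<Phi> v" for v
  proof -
    have "ereal p \<le> ereal v"
      unfolding p using that by (intro Inf_lower) auto
    then show ?thesis
      by (simp add: p_def)
  qed
  have "y \<le> \<Phi> p"
  proof (rule ccontr)
    assume "\<not> y \<le> \<Phi> p"
    moreover have "(\<Phi> \<longlongrightarrow> \<Phi> p) (at p within (I \<inter> {p..}))"
      using rc pI by (simp add: continuous_within)
    ultimately have "eventually (\<lambda>v. \<Phi> v < y) (at p within (I \<inter> {p..}))"
      by (intro order_tendstoD) auto
    then obtain e where e: "e > 0" "\<And>v. v \<in> I \<Longrightarrow> p \<le> v \<Longrightarrow> v \<noteq> p \<Longrightarrow> dist v p < e \<Longrightarrow> \<Phi> v < y"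
      unfolding eventually_at by auto
    have "ereal (p + e) \<le> Inf (ereal ` ?S)"
    proof (rule Inf_greatest)
      fix z assume "z \<in> ereal ` ?S"
      then obtain v where v: "z = ereal v" "v \<in> I" "y \<le> \<Phi> v" by auto
      have "p \<le> v"
        using Inf_lower[of "ereal v" "ereal ` ?S"] v by (auto simp flip: p)
      moreover have "v \<noteq> p"
        using v \<open>\<not> y \<le> \<Phi> p\<close> by auto
      ultimately show "ereal (p + e) \<le> z"
        using e(2)[of v] v by (force simp: dist_real_def)
    qed
    then show False
      using e by (simp flip: p)
  qed
  then show "y \<le> \<Phi> (gen_inverse I \<Phi> y)"
    by (simp add: p_def)
qed

section \<open>Transfer from \<open>{l..u}\<close> to \<open>I\<close>\<close>

theorem lemmaA1:
  fixes I :: "real set" and \<Phi> \<Gamma> :: "real \<Rightarrow> real" and l u t \<xi> :: real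
  assumes "is_interval I"
    and "mono_on I \<Phi>"
    and "\<forall>v\<in>I. continuous (at v within (I \<inter> {v..})) \<Phi>"
    and "l \<in> \<Phi> ` I" and "u \<in> \<Phi> ` I" and "l < u"
    and "gen_inverse_ereal I \<Phi> ` {l..u} \<subseteq> ereal ` I"
    and "convex_minorants l u (\<Gamma> \<circ> gen_inverse I \<Phi>) \<noteq> {}"
    and "closed (\<Phi> ` I \<inter> {l..u})"
    and "\<xi> \<in> I" and "\<Phi> \<xi> \<in> {l<..<u}"
  defines "\<theta> \<equiv> left_deriv (GCM l u (\<Gamma> \<circ> gen_inverse I \<Phi>)) \<circ> \<Phi>"
    and "f \<equiv> \<lambda>x. t * \<Phi> x - LSC_Phi I \<Phi> l u \<Gamma> x"
    and "X \<equiv> gen_inverse I \<Phi> ` {l..u}"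
  shows "(\<exists>m \<in> argmax_set f X. \<forall>x \<in> argmax_set f X. x \<le> m) \<and>
         (\<theta> \<xi> > t \<longleftrightarrow> max_argmax f X < gen_inverse I \<Phi> (\<Phi> \<xi>))"
proof -
  define P where "P = gen_inverse I \<Phi>"
  define C where "C = \<Phi> ` I \<inter> {l..u}"
  define G where "G = \<Gamma> \<circ> P"
  define k where "k s = LSC {l..u} G s - t * s" for s
  obtain v where v: "v \<in> I" "\<Phi> v = u"
    using assms(5) by auto
  have "gen_inverse_ereal I \<Phi> s \<in> ereal ` I" "\<exists>v\<in>I. s \<le> \<Phi> v" if "s \<in> {l..u}" for s
    using that v assms(7) by (auto intro!: bexI[of _ v])
  note P_props = gen_inverse_props[OF assms(3) this, folded P_def]
  have P_I: "P s \<in> I" and P_ge: "s \<le> \<Phi> (P s)" if "s \<in> {l..u}" for s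
    using P_props that by auto
  have P_le: "P s \<le> v" if "s \<in> {l..u}" "v \<in> I" "s \<le> \<Phi> v" for s v
    using P_props that by auto
  have P_mono: "P s \<le> P s'" if "s \<in> {l..u}" "s' \<in> {l..u}" "s \<le> s'" for s s'
    using P_le[OF that(1) P_I[OF that(2)]] P_ge[OF that(2)] that by linarith
  \<comment> \<open>Any \<open>v\<close> with \<open>\<Phi> v = c\<close> bounds \<open>P s\<close>
    from above, and \<open>\<Phi>\<close> is monotone.\<close>
  have Phi_P_le: "\<Phi> (P s) \<le> c" if "s \<in> {l..u}" "c \<in> C" "s \<le> c" for s c
    using that P_le P_I monotone_onD[OF assms(2)] by (auto simp: C_def)
  have C_sub: "C \<subseteq> {l..u}" and uC: "u \<in> C" and lC: "l \<in> C"
    using assms(4-6) by (auto simp: C_def)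
  have Phi_P_C: "\<Phi> (P s) \<in> C" if "s \<in> {l..u}" for s
    using P_I[OF that] P_ge[OF that] Phi_P_le[OF that uC] that by (auto simp: C_def)
  have Phi_P: "\<Phi> (P c) = c" if "c \<in> C" for c
    using that C_sub Phi_P_le[of c c] P_ge[of c] by force
  have P_Phi_P: "P (\<Phi> (P s)) = P s" if "s \<in> {l..u}" for s
  proof (rule order_antisym)
    have *: "\<Phi> (P s) \<in> {l..u}"
      using Phi_P_C[OF that] C_sub by blast
    show "P (\<Phi> (P s)) \<le> P s"
      using * P_I[OF that] by (intro P_le) auto
    show "P s \<le> P (\<Phi> (P s))"
      using * that P_ge by (intro P_mono) auto
  qed
  \<comment> \<open>\<open>\<Phi>\<close> inverts \<open>P\<close> on \<open>C\<close>, so the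
    monotone \<open>P\<close> is injective there.\<close>
  have P_less_iff: "P c < P c' \<longleftrightarrow> c < c'" if "c \<in> C" "c' \<in> C" for c c'
  proof -
    have "c \<in> {l..u}" "c' \<in> {l..u}"
      using that C_sub by auto
    then have "c \<le> c' \<Longrightarrow> P c \<le> P c'" "c' \<le> c \<Longrightarrow> P c' \<le> P c"
      using P_mono by blast+
    moreover have "P c = P c' \<Longrightarrow> c = c'"
      using Phi_P that by metis
    ultimately show ?thesis
      by fastforce
  qed
  \<comment> \<open>Replacing \<open>s\<close> by the point \<open>\<Phi> (P s)\<close> of
    \<open>C\<close> leaves \<open>P s\<close> unchanged.\<close>
  have X_eq: "X = P ` C"
  proof
    show "X \<subseteq> P ` C"
      unfolding X_def P_def[symmetric] using P_Phi_P Phi_P_C by (metis image_eqI image_subsetI)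
    show "P ` C \<subseteq> X"
      unfolding X_def P_def[symmetric] using C_sub by auto
  qed
  \<comment> \<open>Maximising \<open>f\<close> over \<open>X\<close> thus amounts to minimising
    \<open>k\<close> over \<open>C\<close>.\<close>
  have f_P: "f (P c) = - k c" if "c \<in> C" for c
    using Phi_P[OF that] by (simp add: f_def LSC_Phi_def k_def G_def P_def)
  have G_const: "G s = G s'"
    if s: "s \<in> {l..u}" "s' \<in> {l..u}" "s \<le> s'" "C \<inter> {s..<s'} = {}" for s s'
  proof -
    \<comment> \<open>\<open>\<Phi> (P s)\<close> is a point of \<open>C\<close> not below
      \<open>s\<close>, so it lies beyond all of \<open>{s..<s'}\<close>.\<close>
    have "s' \<le> \<Phi> (P s)"
      using Phi_P_C[OF s(1)] P_ge[OF s(1)] s(4) by force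
    then have "P s' \<le> P s"
      using s P_I by (intro P_le) auto
    then show ?thesis
      using P_mono[OF s(1-3)] by (simp add: G_def)
  qed
  have ne: "convex_minorants l u G \<noteq> {}"
    using assms(8) by (simp add: G_def P_def)
  have y: "l < \<Phi> \<xi>" "\<Phi> \<xi> < u"
    using assms(11) by auto
  have yC: "\<Phi> \<xi> \<in> C"
    using y assms(10) by (auto simp: C_def)
  note ne' = lsc_minorants_nonempty[OF ne assms(6)]
  have "closed C"
    using assms(9) by (simp add: C_def)
  obtain m where m: "m \<in> C" "\<And>s. s \<in> {l..u} \<Longrightarrow> k m \<le> k s"
    "\<And>s. s \<in> {l..u} \<Longrightarrow> m < s \<Longrightarrow> k m < k s"
    unfolding k_def
    using greatest_minimiser_LSC_in_closed[OF ne' \<open>closed C\<close> C_sub lC uC G_const] by blast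
  have argmax_eq: "argmax_set f X = P ` {c \<in> C. \<forall>c'\<in>C. k c \<le> k c'}"
  proof -
    have "x \<in> argmax_set f X \<longleftrightarrow> (\<exists>c\<in>C. x = P c \<and> (\<forall>c'\<in>C. f (P c') \<le> f (P c)))" for x
      unfolding argmax_set_def is_arg_max_linorder X_eq by blast
    then show ?thesis
      using f_P by auto
  qed
  have m_max: "P m \<in> argmax_set f X"
    unfolding argmax_eq using m(1,2) C_sub by blast
  have m_greatest: "x \<le> P m" if x: "x \<in> argmax_set f X" for x
  proof -
    obtain c where c: "x = P c" "c \<in> C" "k c \<le> k m"
      using x m(1) unfolding argmax_eq by blast
    then have "\<not> m < c"
      using m(3)[of c] C_sub by auto
    then show ?thesis
      using c P_less_iff[OF m(1) c(2)] by simp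
  qed
  have "max_argmax f X = P m"
    unfolding max_argmax_def using m_max m_greatest by (intro Greatest_equality)
  moreover have "t < left_deriv (GCM l u G) (\<Phi> \<xi>) \<longleftrightarrow> m < \<Phi> \<xi>"
    using left_deriv_GCM_gt_iff[OF ne y subsetD[OF C_sub m(1)]] m(2,3) unfolding k_def by blast
  \<comment> \<open>Both \<open>m\<close> and \<open>\<Phi> \<xi>\<close> lie in \<open>C\<close>,
    where \<open>P\<close> preserves and reflects strict order.\<close>
  then have "t < \<theta> \<xi> \<longleftrightarrow> P m < P (\<Phi> \<xi>)"
    using P_less_iff[OF m(1) yC] by (simp add: \<theta>_def G_def P_def)
  ultimately have "t < \<theta> \<xi> \<longleftrightarrow> max_argmax f X < P (\<Phi> \<xi>)"
    by simp
  then show ?thesis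
    using m_max m_greatest unfolding P_def by blast
qed

end
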